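(* Let $M_1=AKA$ and $M_2=KAK$, where $A(r,s)=(s-r,s)$ and $K(r,s)=(1-r,\tfrac12-r+s)$. For $(r,s)=(1/8,5/8)$, $(1/8,7/8)$, or $(1/12,11/12)$, there are algebraic constants $\alpha_1,\alpha_2$ such that $$F(r,s)=\alpha_1\cdot F(M_1(r,s))+\alpha_2\cdot F(M_2(r,s)).$$
   Context: For rational $0<r<s<3/2$ with $24r\in\mathbb{Z}$, $$F(r,s)=\frac{2^{1-4r}B(r,s-r)}{N(r)}\;{}_3F_2\!\left[\begin{matrix}1/2,\,1/2,\,r\\ 1,\,s\end{matrix};1\right],$$ where $B$ is the beta function and $N(r)=48/\gcd(24r,24)$ (equal to $2b$ if $r$ has denominator $b$ in lowest terms). Products of $A$ and $K$ denote composition of maps on pairs of rational numbers. *)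

theory Defs
  imports "HOL-Analysis.Analysis"
begin

(* The series at z = 1 lies on the boundary of the disc of convergence; it converges
   there when 1 + s - (1/2 + 1/2 + r) = s - r > 0.  eval_fps is the sum of the series
   itself, so it is the intended value also at this boundary point. *)
definition hypergeo_pFq :: "real list \<Rightarrow> real list \<Rightarrow> real \<Rightarrow> real" where
  "hypergeo_pFq as bs z = eval_fps (fps_hypergeo as bs 1) z"

definition F_domain :: "(rat \<times> rat) set" where
  "F_domain = {(r, s). 0 < r \<and> r < s \<and> s < 3/2 \<and> 24 * r \<in> \<int>}"

(* The floor only turns the rational integer 24 r into an element of type int. *)
definition N_level :: "rat \<Rightarrow> real" where
  "N_level r = 48 / real_of_int (gcd \<lfloor>24 * r\<rfloor> 24)"

(* Meaningful only on F_domain; elsewhere the value is an artefact of totality. *)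
definition F_hyp :: "rat \<times> rat \<Rightarrow> real" where
  "F_hyp = (\<lambda>(r, s).
     2 powr (1 - 4 * of_rat r) * Beta (of_rat r) (of_rat (s - r)) / N_level r *
     hypergeo_pFq [1/2, 1/2, of_rat r] [1, of_rat s] 1)"

definition A_map :: "rat \<times> rat \<Rightarrow> rat \<times> rat" where
  "A_map = (\<lambda>(r, s). (s - r, s))"

definition K_map :: "rat \<times> rat \<Rightarrow> rat \<times> rat" where
  "K_map = (\<lambda>(r, s). (1 - r, 1/2 - r + s))"

definition M1_map :: "rat \<times> rat \<Rightarrow> rat \<times> rat" where
  "M1_map = A_map \<circ> K_map \<circ> A_map"

definition M2_map :: "rat \<times> rat \<Rightarrow> rat \<times> rat" where
  "M2_map = K_map \<circ> A_map \<circ> K_map"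

lemma M1_map_apply: "M1_map (r, s) = (s - 1/2, r + 1/2)"
  by (simp add: M1_map_def A_map_def K_map_def)

lemma M2_map_apply: "M2_map (r, s) = (3/2 - s, 3/2 - r)"
  by (simp add: M2_map_def A_map_def K_map_def)

lemma F_domainI:
  assumes "24 * r = of_int m" "0 < r" "r < s" "s < 3/2"
  shows "(r, s) \<in> F_domain"
  using assms by (simp add: F_domain_def)

lemma F_domain_points:
  assumes "p \<in> {(1/8, 5/8), (1/8, 7/8), (1/12, 11/12)}"
  shows "p \<in> F_domain" "M1_map p \<in> F_domain" "M2_map p \<in> F_domain"
proof -
  have "(1/8, 5/8) \<in> F_domain" by (rule F_domainI[where m = 3]) simp_all
  moreover have "(1/8, 7/8) \<in> F_domain" by (rule F_domainI[where m = 3]) simp_all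
  moreover have "(3/8, 5/8) \<in> F_domain" by (rule F_domainI[where m = 9]) simp_all
  moreover have "(1/12, 11/12) \<in> F_domain" by (rule F_domainI[where m = 2]) simp_all
  moreover have "(5/12, 7/12) \<in> F_domain" by (rule F_domainI[where m = 10]) simp_all
  moreover have "(7/8, 11/8) \<in> F_domain" by (rule F_domainI[where m = 21]) simp_all
  moreover have "(5/8, 11/8) \<in> F_domain" by (rule F_domainI[where m = 15]) simp_all
  moreover have "(7/12, 17/12) \<in> F_domain" by (rule F_domainI[where m = 14]) simp_all
  ultimately show "p \<in> F_domain" "M1_map p \<in> F_domain" "M2_map p \<in> F_domain"
    using assms by (auto simp: M1_map_apply M2_map_apply)
qed

end

theory Submission
  imports Defs "HOL-Real_Asymp.Real_Asymp"
begin

text \<open>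
Put \<open>F x = 2F1(1/2, 1/2; 1; x)\<close>. Up to elementary factors, the function in question is the moment
\<open>I r s = \<integral> x\<^sup>r\<^sup>-\<^sup>1 (1 - x)\<^sup>s\<^sup>-\<^sup>r\<^sup>-\<^sup>1 F x dx\<close> over the unit interval, because integrating the
series of \<open>F\<close> term by term against a beta density gives \<open>I r s = B(r, s - r) 3F2(1/2, 1/2, r; 1, s; 1)\<close>.
The point \<open>(1/8, 5/8)\<close> is fixed by \<open>AKA\<close>, so there is nothing to show for it. The other two points
have the form \<open>(r, 1 - r)\<close> and are instances of one identity, valid for \<open>0 < r < 1/2\<close>:

\<open>I r (1 - r) = 2 * 16 powr (-r) * sin (2 \<pi> r) * I (1/2 - r) (1/2 + r) - cos (2 \<pi> r) * I (1/2 + r) (3/2 - r)\<close>.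

Two transformations produce it. The first is Landen's, \<open>F (4t/(1+t)\<^sup>2) = (1 + t) F (t\<^sup>2)\<close>
(\<open>landen_transformation\<close>). The substitution \<open>z = 4t/(1+t)\<^sup>2\<close> turns the moments
\<open>a = I (2r) (r + 1/2)\<close> and \<open>b = I (2r) (r + 1)\<close> into integrals against \<open>F (t\<^sup>2)\<close> whose weights are
\<open>1 + t\<close> and \<open>1 - t\<close> times a common factor, while \<open>x = t\<^sup>2\<close> turns \<open>I r (1 - r)\<close> and
\<open>I (1/2 + r) (3/2 - r)\<close> into integrals with the weights \<open>2\<close> and \<open>2t\<close> times that same factor
divided by \<open>16 powr r\<close>. Hence
the last two moments are \<open>16 powr (-r)\<close> times \<open>a + b\<close> and \<open>a - b\<close> (\<open>kernel_moment_landen\<close>).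
Replacing \<open>r\<close> by \<open>1/2 - r\<close> expresses \<open>I (1/2 - r) (1/2 + r)\<close> as a multiple of \<open>a' + b'\<close>, where
\<open>a' = I (1 - 2r) (1 - r)\<close> and \<open>b' = I (1 - 2r) (3/2 - r)\<close>.

The second is a transformation of Thomae type, the symmetry behind the map \<open>K\<close>. It gives
\<open>I r s\<close> as a quotient of gamma values times \<open>I (1 - r) (1/2 + s - r)\<close>
(\<open>kernel_moment_transformation\<close>), and it pairs \<open>a\<close> with \<open>a'\<close> and \<open>b\<close> with \<open>b'\<close>. By the
duplication and reflection formulas the two gamma quotients are \<open>16 powr r / 2\<close> times
\<open>tan (\<pi> r)\<close> and \<open>cot (\<pi> r)\<close>. Eliminating \<open>a, b, a', b'\<close> leaves the identity above. At
\<open>r = 1/8\<close> and \<open>r = 1/12\<close> the coefficients of the theorem come out as \<open>2\<close> and \<open>-sqrt 8\<close>, and as \<open>2\<close> and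
\<open>-sqrt 12\<close>.

All integrands are nonnegative, so integrals take values in the extended nonnegative reals until
the identities have been established. Sums and integrals can then be interchanged freely, and
convergence enters only through the summability of the hypergeometric series.
\<close>

section \<open>Moments of hypergeometric functions\<close>

text \<open>
Euler's integral for \<open>\<pi> * 2F1(a, 1/2; 1; x)\<close>. For \<open>a = 1/2\<close> it is twice the complete elliptic
integral of the first kind with parameter \<open>x\<close>.
\<close>

definition euler_integral :: "real \<Rightarrow> real \<Rightarrow> ennreal" where
  "euler_integral a x =
     (\<integral>\<^sup>+u\<in>{0<..<1}. ennreal (u powr (-1/2) * (1 - u) powr (-1/2) * (1 - x * u) powr (-a)) \<partial>lborel)"

text \<open>
The exponent \<open>a\<close> of the kernel and the exponent \<open>c\<close> of the beta density are separate parameters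
because, up to a quotient of beta values, they can be exchanged; the Thomae transformation rests on
this.
\<close>

definition beta_integral :: "real \<Rightarrow> real \<Rightarrow> real \<Rightarrow> ennreal" where
  "beta_integral a c e =
     (\<integral>\<^sup>+x\<in>{0<..<1}. ennreal (x powr (c - 1) * (1 - x) powr (e - c - 1)) * euler_integral a x \<partial>lborel)"

lemma euler_integral_measurable [measurable]: "euler_integral a \<in> borel_measurable borel"
  unfolding euler_integral_def by measurable

lemma nn_integral_Beta:
  fixes p q :: real
  assumes "0 < p" "0 < q"
  shows "(\<integral>\<^sup>+x\<in>{0<..<1}. ennreal (x powr (p - 1) * (1 - x) powr (q - 1)) \<partial>lborel) = ennreal (Beta p q)"
proof -
  have "((\<lambda>t. t powr (p - 1) * (1 - t) powr (q - 1)) has_integral Beta p q) {0<..<1}"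
    using has_integral_Beta_real[OF assms] by (simp add: has_integral_Icc_iff_Ioo)
  from nn_integral_has_integral_lebesgue[OF _ this]
  have "(\<integral>\<^sup>+x. ennreal (indicator {0<..<1} x * (x powr (p - 1) * (1 - x) powr (q - 1))) \<partial>lborel)
      = ennreal (Beta p q)" by simp
  also have "(\<integral>\<^sup>+x. ennreal (indicator {0<..<1} x * (x powr (p - 1) * (1 - x) powr (q - 1))) \<partial>lborel)
      = (\<integral>\<^sup>+x\<in>{0<..<1}. ennreal (x powr (p - 1) * (1 - x) powr (q - 1)) \<partial>lborel)"
    by (intro nn_integral_cong) (auto split: split_indicator)
  finally show ?thesis .
qed

lemma Beta_add_nat:
  fixes p q :: real
  assumes "0 < p" "0 < q"
  shows "Beta (p + real n) q = Beta p q * pochhammer p n / pochhammer (p + q) n"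
proof -
  have "pochhammer p n = Gamma (p + n) / Gamma p"
       "pochhammer (p + q) n = Gamma (p + q + n) / Gamma (p + q)"
    using assms by (auto intro!: pochhammer_Gamma elim!: nonpos_Ints_cases)
  moreover have "Gamma p > 0" "Gamma (p + q) > 0" "Gamma (p + q + n) > 0"
    using assms by (auto intro!: Gamma_real_pos)
  ultimately show ?thesis
    by (simp add: Beta_def field_simps add_ac)
qed

lemma one_minus_powr_sums:
  fixes a y :: real
  assumes "0 < a" "0 \<le> y" "y < 1"
  shows "(\<Sum>n. ennreal (pochhammer a n / fact n * y ^ n)) = ennreal ((1 - y) powr (-a))"
proof (rule suminf_ennreal_eq)
  show "0 \<le> pochhammer a n / fact n * y ^ n" for n
    using assms by (intro mult_nonneg_nonneg divide_nonneg_nonneg) (auto intro: pochhammer_nonneg)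
  have "(\<lambda>n. ((-a) gchoose n) * (-y) ^ n) sums (1 + (-y)) powr (-a)"
    using assms by (intro gen_binomial_real) auto
  moreover have "((-a) gchoose n) * (-y) ^ n = pochhammer a n / fact n * y ^ n" for n
  proof -
    have "(-1) ^ n * (-y) ^ n = y ^ n" by (simp flip: power_mult_distrib)
    then show ?thesis by (simp add: gbinomial_pochhammer mult_ac)
  qed
  ultimately show "(\<lambda>n. pochhammer a n / fact n * y ^ n) sums (1 - y) powr (-a)"
    by simp
qed

text \<open>
Expand \<open>(1 - x u) powr -a\<close> by the binomial series; each power of \<open>u\<close> leaves a beta integral.
\<close>

lemma euler_integral_series:
  assumes a: "0 < a" and x: "0 < x" "x < 1"
  shows "euler_integral a x =
    (\<Sum>n. ennreal (pochhammer a n / fact n * Beta (1/2 + real n) (1/2) * x ^ n))"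
proof -
  let ?b = "\<lambda>n u. u powr (1/2 + real n - 1) * (1 - u) powr (1/2 - 1)"
  let ?c = "\<lambda>n. pochhammer a n / fact n * x ^ n"
  have c: "0 \<le> ?c n" for n
    using assms by (auto intro!: mult_nonneg_nonneg divide_nonneg_nonneg intro: pochhammer_nonneg)
  have "euler_integral a x = (\<integral>\<^sup>+u. (\<Sum>n. ennreal (?c n) * (ennreal (?b n u) * indicator {0<..<1} u)) \<partial>lborel)"
    unfolding euler_integral_def
  proof (rule nn_integral_cong)
    fix u :: real
    show "ennreal (u powr (- 1 / 2) * (1 - u) powr (- 1 / 2) * (1 - x * u) powr - a) * indicator {0<..<1} u
       = (\<Sum>n. ennreal (?c n) * (ennreal (?b n u) * indicator {0<..<1} u))"
    proof (cases "u \<in> {0<..<1}")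
      case True
      then have u: "0 < u" "u < 1" by auto
      have xu: "0 \<le> x * u" "x * u < 1"
        using u x mult_strict_mono[of x 1 u 1] by auto
      have "ennreal (u powr (- 1 / 2) * (1 - u) powr (- 1 / 2) * (1 - x * u) powr - a)
          = ennreal (u powr (- 1 / 2) * (1 - u) powr (- 1 / 2)) * (\<Sum>n. ennreal (pochhammer a n / fact n * (x * u) ^ n))"
        using one_minus_powr_sums[OF a xu] by (simp add: ennreal_mult')
      also have "\<dots> = (\<Sum>n. ennreal (u powr (- 1 / 2) * (1 - u) powr (- 1 / 2)) * ennreal (pochhammer a n / fact n * (x * u) ^ n))"
        by simp
      also have "\<dots> = (\<Sum>n. ennreal (?c n) * ennreal (?b n u))"
      proof (rule suminf_cong)
        fix n
        have "u powr (1/2 + real n - 1) = u powr (-1/2) * u ^ n"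
          using u by (simp add: powr_add[symmetric] flip: powr_realpow)
        then have eq: "u powr (- 1 / 2) * (1 - u) powr (- 1 / 2) * (pochhammer a n / fact n * (x * u) ^ n) = ?c n * ?b n u"
          by (simp add: power_mult_distrib)
        have k: "0 \<le> pochhammer a n / fact n * (x * u) ^ n"
          using a xu by (intro mult_nonneg_nonneg divide_nonneg_nonneg) (auto intro: pochhammer_nonneg)
        show "ennreal (u powr (- 1 / 2) * (1 - u) powr (- 1 / 2)) * ennreal (pochhammer a n / fact n * (x * u) ^ n)
            = ennreal (?c n) * ennreal (?b n u)"
          unfolding ennreal_mult''[OF k, symmetric] ennreal_mult'[OF c, symmetric] eq ..
      qed
      finally show ?thesis using True by simp
    qed simp
  qed
  also have "\<dots> = (\<Sum>n. ennreal (?c n) * (\<integral>\<^sup>+u\<in>{0<..<1}. ennreal (?b n u) \<partial>lborel))"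
    by (subst nn_integral_suminf) (auto simp: nn_integral_cmult)
  also have "\<dots> = (\<Sum>n. ennreal (?c n) * ennreal (Beta (1/2 + real n) (1/2)))"
    by (subst nn_integral_Beta) auto
  also have "\<dots> = (\<Sum>n. ennreal (pochhammer a n / fact n * Beta (1/2 + real n) (1/2) * x ^ n))"
    using c by (intro suminf_cong) (simp add: ennreal_mult'[symmetric] mult_ac)
  finally show ?thesis .
qed

text \<open>
The terms of \<open>3F2(a, 1/2, c; 1, e; 1)\<close>, in a form that shows the symmetry between \<open>a\<close> and \<open>c\<close>; one of
the two factorials is the Pochhammer symbol of the lower parameter \<open>1\<close>.
\<close>

definition hyp_term :: "real \<Rightarrow> real \<Rightarrow> real \<Rightarrow> nat \<Rightarrow> real" where
  "hyp_term a c e n =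
     pochhammer a n * pochhammer (1/2) n * pochhammer c n / (fact n * fact n * pochhammer e n)"

lemma hyp_term_pos: "0 < a \<Longrightarrow> 0 < c \<Longrightarrow> 0 < e \<Longrightarrow> 0 < hyp_term a c e n"
  unfolding hyp_term_def by (intro divide_pos_pos mult_pos_pos pochhammer_pos) auto

lemma Beta_half_half: "Beta (1/2) (1/2 :: real) = pi"
  by (simp add: Beta_def Gamma_one_half_real)

lemma Beta_pos: "0 < p \<Longrightarrow> 0 < q \<Longrightarrow> 0 < Beta p (q::real)"
  by (simp add: Beta_def)

text \<open>
Term-by-term integration raises the index of the hypergeometric function. The series on the right is
symmetric in \<open>a\<close> and \<open>c\<close>, whereas the integral on the left does not look so.
\<close>

lemma beta_integral_series:
  assumes a: "0 < a" and c: "0 < c" and e: "c < e"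
  shows "beta_integral a c e = ennreal (pi * Beta c (e - c)) * (\<Sum>n. ennreal (hyp_term a c e n))"
proof -
  let ?b = "\<lambda>n x. x powr (c + real n - 1) * (1 - x) powr (e - c - 1)"
  let ?k = "\<lambda>n. pochhammer a n / fact n * Beta (1/2 + real n) (1/2)"
  have k: "0 \<le> ?k n" for n
    using a by (intro mult_nonneg_nonneg divide_nonneg_nonneg less_imp_le[OF Beta_pos])
      (auto intro: pochhammer_nonneg)
  have "beta_integral a c e = (\<integral>\<^sup>+x. (\<Sum>n. ennreal (?k n) * (ennreal (?b n x) * indicator {0<..<1} x)) \<partial>lborel)"
    unfolding beta_integral_def
  proof (rule nn_integral_cong)
    fix x :: real
    show "ennreal (x powr (c - 1) * (1 - x) powr (e - c - 1)) * euler_integral a x * indicator {0<..<1} x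
       = (\<Sum>n. ennreal (?k n) * (ennreal (?b n x) * indicator {0<..<1} x))"
    proof (cases "x \<in> {0<..<1}")
      case True
      then have x: "0 < x" "x < 1" by auto
      have "ennreal (x powr (c - 1) * (1 - x) powr (e - c - 1)) * euler_integral a x =
        (\<Sum>n. ennreal (x powr (c - 1) * (1 - x) powr (e - c - 1)) * ennreal (?k n * x ^ n))"
        using euler_integral_series[OF a x] by simp
      also have "\<dots> = (\<Sum>n. ennreal (?k n) * ennreal (?b n x))"
      proof (rule suminf_cong)
        fix n
        have "x powr (c + real n - 1) = x powr (c - 1) * x ^ n"
          using x by (simp add: powr_add[symmetric] algebra_simps flip: powr_realpow)
        then have eq: "x powr (c - 1) * (1 - x) powr (e - c - 1) * (?k n * x ^ n) = ?k n * ?b n x"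
          by simp
        have "0 \<le> ?k n * x ^ n" using k[of n] x by (intro mult_nonneg_nonneg[OF k]) auto
        then show "ennreal (x powr (c - 1) * (1 - x) powr (e - c - 1)) * ennreal (?k n * x ^ n)
            = ennreal (?k n) * ennreal (?b n x)"
          using eq k[of n] by (metis ennreal_mult' ennreal_mult'')
      qed
      finally show ?thesis using True by simp
    qed simp
  qed
  also have "\<dots> = (\<Sum>n. ennreal (?k n) * (\<integral>\<^sup>+x\<in>{0<..<1}. ennreal (?b n x) \<partial>lborel))"
    by (subst nn_integral_suminf) (auto simp: nn_integral_cmult)
  also have "\<dots> = (\<Sum>n. ennreal (?k n) * ennreal (Beta (c + real n) (e - c)))"
    using c e by (subst nn_integral_Beta) auto
  also have "\<dots> = (\<Sum>n. ennreal (pi * Beta c (e - c)) * ennreal (hyp_term a c e n))"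
  proof (rule suminf_cong)
    fix n
    have "?k n * Beta (c + real n) (e - c) = pi * Beta c (e - c) * hyp_term a c e n"
      using c e Beta_add_nat[of "1/2" "1/2" n] Beta_add_nat[of c "e - c" n]
      by (simp add: hyp_term_def Beta_half_half pochhammer_fact)
    moreover have "0 < Beta c (e - c)" using c e by (intro Beta_pos) auto
    ultimately show "ennreal (?k n) * ennreal (Beta (c + real n) (e - c))
        = ennreal (pi * Beta c (e - c)) * ennreal (hyp_term a c e n)"
      using k[of n] by (simp flip: ennreal_mult' )
  qed
  finally show ?thesis by simp
qed

text \<open>
The terms decay like \<open>n powr (c - e - 1)\<close>, and Raabe's test detects this from the limit
\<open>1 + e - c > 1\<close>.
\<close>

lemma summable_hyp_term:
  assumes "0 < c" "c < e"
  shows "summable (hyp_term (1/2) c e)"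
proof (rule raabes_test_convergence)
  have pos: "0 < hyp_term (1/2) c e n" for n
    using assms by (intro hyp_term_pos) auto
  show "\<forall>\<^sub>F n in sequentially. 0 < hyp_term (1/2) c e n"
    using pos by simp
  have ratio: "hyp_term (1/2) c e n / hyp_term (1/2) c e (Suc n) =
      (real n + 1)\<^sup>2 * (real n + e) / ((real n + 1/2)\<^sup>2 * (real n + c))" for n
  proof -
    have p: "pochhammer (1/2::real) n > 0" "pochhammer c n > 0" "pochhammer e n > 0"
      using assms by (auto intro: pochhammer_pos)
    have "hyp_term (1/2) c e (Suc n) = hyp_term (1/2) c e n *
       (((real n + 1/2)\<^sup>2 * (real n + c)) / ((real n + 1)\<^sup>2 * (real n + e)))"
      using p by (simp add: hyp_term_def pochhammer_Suc power2_eq_square add_ac mult_ac)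
    then show ?thesis using pos[of n] by simp
  qed
  have "(\<lambda>n. real n * (hyp_term (1/2) c e n / hyp_term (1/2) c e (Suc n) - 1)) \<longlonglongrightarrow> 1 + e - c"
    unfolding ratio by real_asymp
  then have "(\<lambda>n. ereal (real n * (hyp_term (1/2) c e n / hyp_term (1/2) c e (Suc n) - 1))) \<longlonglongrightarrow> ereal (1 + e - c)"
    by simp
  from lim_imp_Liminf[OF _ this] assms
  show "1 < liminf (\<lambda>n. ereal (real n * (hyp_term (1/2) c e n / hyp_term (1/2) c e (Suc n) - 1)))"
    by simp
qed

section \<open>Transformations of the kernel\<close>

text \<open>
All changes of variables below are increasing maps of the unit interval onto itself. They extend
smoothly to the end points, but the integrands may be singular there; the end points form a null set,
so the open interval can be used throughout.
\<close>

lemma nn_integral_unit_interval_substitution: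
  fixes f :: "real \<Rightarrow> ennreal"
  assumes [measurable]: "f \<in> borel_measurable borel"
    and "g 0 = 0" "g 1 = 1"
    and "\<And>x. x \<in> {0..1} \<Longrightarrow> (g has_real_derivative g' x) (at x)"
    and "continuous_on {0..1} g'" and "\<And>x. x \<in> {0..1} \<Longrightarrow> 0 \<le> g' x"
  shows "(\<integral>\<^sup>+x\<in>{0<..<1}. f x \<partial>lborel) = (\<integral>\<^sup>+x\<in>{0<..<1}. f (g x) * ennreal (g' x) \<partial>lborel)"
proof -
  have ends: "(\<integral>\<^sup>+x\<in>{0<..<1}. h x \<partial>lborel) = (\<integral>\<^sup>+x\<in>{0..1}. h x \<partial>lborel)" for h :: "real \<Rightarrow> ennreal"
  proof (rule nn_integral_cong_AE)
    have "AE x in lborel. x \<noteq> (0::real)" "AE x in lborel. x \<noteq> (1::real)"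
      by (rule AE_lborel_singleton)+
    then show "AE x in lborel. h x * indicator {0<..<1::real} x = h x * indicator {0..1} x"
      by eventually_elim (auto split: split_indicator)
  qed
  show ?thesis
    unfolding ends using nn_integral_substitution_aux[of f 0 1 g g'] assms by simp
qed

text \<open>
Euler's transformation \<open>2F1(a, 1/2; 1; x) = (1 - x) powr (1/2 - a) * 2F1(1 - a, 1/2; 1; x)\<close>. The
substitution \<open>v = (1 - u) / (1 - x u)\<close> sends \<open>1 - x v\<close> to \<open>(1 - x) / (1 - x u)\<close>, which inverts the
factor carrying the exponent. As it is decreasing, it is carried out as the increasing
\<open>u / (1 - x + x u)\<close> followed by the reflection of the interval.
\<close>

lemma euler_integral_transformation:
  assumes x: "0 < x" "x < 1"
  shows "euler_integral a x = ennreal ((1 - x) powr (1/2 - a)) * euler_integral (1 - a) x"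
proof -
  define D where "D u = 1 - x + x * u" for u
  have D: "0 < D u" if "0 \<le> u" for u
    using that x by (auto simp: D_def intro: add_pos_nonneg)
  let ?f = "\<lambda>u. ennreal (u powr (-1/2) * (1 - u) powr (-1/2) * (1 - x * u) powr (-a))"
  let ?h = "\<lambda>u. ennreal (u powr (-1/2) * (1 - u) powr (-1/2) * (1 - x * u) powr (-(1 - a)))"
  have "euler_integral a x = (\<integral>\<^sup>+u\<in>{0<..<1}. ?f (u / D u) * ennreal ((1 - x) / (D u)\<^sup>2) \<partial>lborel)"
    unfolding euler_integral_def
  proof (rule nn_integral_unit_interval_substitution)
    fix u :: real assume u: "u \<in> {0..1}"
    have "((\<lambda>u. u / (1 - x + x * u)) has_real_derivative (1 - x) / (1 - x + x * u)\<^sup>2) (at u)"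
      using D[of u] u unfolding D_def
      by (auto intro!: derivative_eq_intros simp: field_simps power2_eq_square)
    then show "((\<lambda>u. u / D u) has_real_derivative (1 - x) / (D u)\<^sup>2) (at u)"
      by (simp add: D_def[abs_def])
    show "0 \<le> (1 - x) / (D u)\<^sup>2" using x by simp
  next
    show "continuous_on {0..1} (\<lambda>u. (1 - x) / (D u)\<^sup>2)"
      using D unfolding D_def by (intro continuous_intros) (auto simp: less_le)
  qed (auto simp: D_def)
  also have "\<dots> = (\<integral>\<^sup>+u\<in>{0<..<1}. ennreal ((1 - x) powr (1/2 - a)) * ?h (1 - u) \<partial>lborel)"
  proof (rule nn_integral_cong)
    fix u :: real
    show "?f (u / D u) * ennreal ((1 - x) / (D u)\<^sup>2) * indicator {0<..<1} u
        = ennreal ((1 - x) powr (1/2 - a)) * ?h (1 - u) * indicator {0<..<1} u"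
    proof (cases "u \<in> {0<..<1}")
      case True
      then have u: "0 < u" "u < 1" by auto
      have Du: "0 < D u" using D u by simp
      have e: "1 - u / D u = (1 - u) * (1 - x) / D u" "1 - x * (u / D u) = (1 - x) / D u"
        "1 - x * (1 - u) = D u"
        using Du by (auto simp: field_simps) (auto simp: D_def field_simps)
      have sq: "(1 - x) / (D u)\<^sup>2 = exp (ln (1 - x) - 2 * ln (D u))"
        using x Du by (simp add: exp_diff exp_double)
      have "(u / D u) powr (-1/2) * (1 - u / D u) powr (-1/2) * (1 - x * (u / D u)) powr (-a) * ((1 - x) / (D u)\<^sup>2)
          = (1 - x) powr (1/2 - a) * ((1 - u) powr (-1/2) * (1 - (1 - u)) powr (-1/2) * (1 - x * (1 - u)) powr (-(1 - a)))"
        unfolding e sq using u x Du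
        by (simp add: powr_def ln_mult ln_div flip: exp_add) (simp add: field_simps)
      then show ?thesis by (simp flip: ennreal_mult' ennreal_mult'')
    qed simp
  qed
  also have "\<dots> = ennreal ((1 - x) powr (1/2 - a)) * (\<integral>\<^sup>+u. ?h (1 - u) * indicator {0<..<1} u \<partial>lborel)"
    by (subst nn_integral_cmult[symmetric]) (auto simp: mult_ac)
  also have "(\<integral>\<^sup>+u. ?h (1 - u) * indicator {0<..<1} u \<partial>lborel) = euler_integral (1 - a) x"
    unfolding euler_integral_def
    by (subst (2) nn_integral_real_affine[where c = "-1" and t = 1])
       (auto intro!: nn_integral_cong split: split_indicator)
  finally show ?thesis .
qed

text \<open>
Landen's substitution in its algebraic form \<open>v = (1 + t)\<^sup>2 u / (1 + t u)\<^sup>2\<close>; with \<open>u\<close> and \<open>v\<close> read as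
squares of sines it is the classical relation of the amplitudes. It works because, for
\<open>z = 4t/(1+t)\<^sup>2\<close>, both \<open>1 - v\<close> and \<open>1 - z v\<close> factor:
\<open>1 - v = (1 - u) (1 - t\<^sup>2 u) / (1 + t u)\<^sup>2\<close> and \<open>1 - z v = (1 - t u)\<^sup>2 / (1 + t u)\<^sup>2\<close>.
\<close>

lemma landen_transformation:
  assumes t: "0 < t" "t < 1"
  shows "euler_integral (1/2) (4 * t / (1 + t)\<^sup>2) = ennreal (1 + t) * euler_integral (1/2) (t\<^sup>2)"
proof -
  let ?z = "4 * t / (1 + t)\<^sup>2"
  let ?f = "\<lambda>x u. ennreal (u powr (-1/2) * (1 - u) powr (-1/2) * (1 - x * u) powr (-(1/2)))"
  let ?g = "\<lambda>u. (1 + t)\<^sup>2 * u / (1 + t * u)\<^sup>2"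
  let ?g' = "\<lambda>u. (1 + t)\<^sup>2 * (1 - t * u) / (1 + t * u) ^ 3"
  have P: "0 < 1 + t * u" if "0 \<le> u" for u
    using that t by (auto intro: add_pos_nonneg)
  have M: "0 < 1 - t * u" if "0 \<le> u" "u \<le> 1" for u
  proof -
    have "t * u \<le> t" using that t by (simp add: mult_left_le)
    then show ?thesis using t by linarith
  qed
  have "euler_integral (1/2) ?z = (\<integral>\<^sup>+u\<in>{0<..<1}. ?f ?z (?g u) * ennreal (?g' u) \<partial>lborel)"
    unfolding euler_integral_def
  proof (rule nn_integral_unit_interval_substitution)
    fix u :: real assume u: "u \<in> {0..1}"
    show "(?g has_real_derivative ?g' u) (at u)"
    proof -
      have p: "0 < 1 + t * u" using P u by simp
      have "((\<lambda>u. (1 + t)\<^sup>2 * u) has_real_derivative (1 + t)\<^sup>2) (at u)"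
        by (auto intro!: derivative_eq_intros)
      moreover have "((\<lambda>u. (1 + t * u)\<^sup>2) has_real_derivative 2 * (1 + t * u) * t) (at u)"
        by (auto intro!: derivative_eq_intros)
      ultimately have "(?g has_real_derivative
          ((1 + t)\<^sup>2 * (1 + t * u)\<^sup>2 - (1 + t)\<^sup>2 * u * (2 * (1 + t * u) * t)) / ((1 + t * u)\<^sup>2 * (1 + t * u)\<^sup>2)) (at u)"
        using p by (intro DERIV_divide) auto
      moreover have "(k * p\<^sup>2 - k * u * (2 * p * t)) / (p\<^sup>2 * p\<^sup>2) = k * (p - 2 * u * t) / p ^ 3"
        if "p > 0" for k p :: real
        using that by (simp add: field_simps power2_eq_square power3_eq_cube)
      moreover have "1 + t * u - 2 * u * t = 1 - t * u" by simp
      ultimately show ?thesis using p by (metis (no_types, lifting) DERIV_cong)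
    qed
    show "0 \<le> ?g' u" using P[of u] M[of u] u by simp
  next
    show "continuous_on {0..1} ?g'"
      using P by (intro continuous_intros) (auto simp: less_le)
  qed (use t in auto)
  also have "\<dots> = (\<integral>\<^sup>+u\<in>{0<..<1}. ennreal (1 + t) * ?f (t\<^sup>2) u \<partial>lborel)"
  proof (rule nn_integral_cong)
    fix u :: real
    show "?f ?z (?g u) * ennreal (?g' u) * indicator {0<..<1} u
        = ennreal (1 + t) * ?f (t\<^sup>2) u * indicator {0<..<1} u"
    proof (cases "u \<in> {0<..<1}")
      case True
      then have u: "0 < u" "u < 1" by auto
      define p m k where "p = 1 + t * u" and "m = 1 - t * u" and "k = 1 + t"
      have pos: "0 < p" "0 < m" "0 < k" using P[of u] M[of u] u t by (auto simp: p_def m_def k_def)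
      have "t\<^sup>2 * u < 1"
        using M[of "t * u"] u t mult_strict_mono[of t 1 u 1] by (simp add: power2_eq_square mult.assoc)
      then have q: "0 < 1 - t\<^sup>2 * u" by simp
      have pk: "p\<^sup>2 - k\<^sup>2 * u = (1 - u) * (1 - t\<^sup>2 * u)" "p\<^sup>2 - 4 * t * u = m\<^sup>2"
        unfolding p_def m_def k_def by (simp_all add: power2_eq_square algebra_simps)
      have g: "?g u = k\<^sup>2 * u / p\<^sup>2" by (simp add: p_def k_def)
      have zg: "?z * ?g u = 4 * t * u / p\<^sup>2"
        unfolding p_def[symmetric] k_def[symmetric] using pos by (simp add: field_simps)
      have e: "1 - ?g u = (1 - u) * (1 - t\<^sup>2 * u) / p\<^sup>2" "1 - ?z * ?g u = m\<^sup>2 / p\<^sup>2"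
        unfolding zg unfolding g pk[symmetric] using pos by (simp_all add: diff_divide_distrib)
      have "?g' u = k powr 2 * m powr 1 * p powr (-3)"
        unfolding p_def[symmetric] m_def[symmetric] k_def[symmetric]
        using pos by (simp add: powr_minus divide_inverse)
      also have "\<dots> = exp (2 * ln k + ln m - 3 * ln p)"
        unfolding powr_def using pos by (simp add: exp_add exp_diff exp_minus divide_inverse)
      finally have g': "?g' u = exp (2 * ln k + ln m - 3 * ln p)" .
      have k: "1 + t = exp (ln k)" using pos by (simp add: k_def)
      have "(?g u) powr (-1/2) * (1 - ?g u) powr (-1/2) * (1 - ?z * ?g u) powr (-(1/2)) * ?g' u
         = (1 + t) * (u powr (-1/2) * (1 - u) powr (-1/2) * (1 - t\<^sup>2 * u) powr (-(1/2)))"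
        unfolding e unfolding g g' unfolding k using u q pos
        by (simp add: powr_def ln_mult ln_div ln_realpow del: exp_ln exp_ln_iff flip: exp_add) (simp add: field_simps)
      then show ?thesis using t by (simp del: ennreal_plus flip: ennreal_mult' ennreal_mult'')
    qed simp
  qed
  also have "\<dots> = ennreal (1 + t) * euler_integral (1/2) (t\<^sup>2)"
    unfolding euler_integral_def by (subst nn_integral_cmult[symmetric]) (auto simp: mult_ac)
  finally show ?thesis .
qed

section \<open>The two relations between moments\<close>

text \<open>
The moment \<open>I r s\<close> of \<open>2F1(1/2, 1/2; 1; x)\<close>, defined through its series so that it is a real number
connected to the function of the theorem by an elementary factor.
\<close>

definition kernel_moment :: "real \<Rightarrow> real \<Rightarrow> real" where
  "kernel_moment r s = Beta r (s - r) * (\<Sum>n. hyp_term (1/2) r s n)"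

lemma suminf_hyp_term_ennreal:
  assumes "0 < r" "r < s"
  shows "(\<Sum>n. ennreal (hyp_term (1/2) r s n)) = ennreal (\<Sum>n. hyp_term (1/2) r s n)"
  using assms hyp_term_pos[of "1/2" r s] summable_hyp_term[of r s]
  by (intro suminf_ennreal2) (auto intro: less_imp_le)

lemma kernel_moment_nonneg:
  assumes "0 < r" "r < s"
  shows "0 \<le> kernel_moment r s"
  unfolding kernel_moment_def
  using assms hyp_term_pos[of "1/2" r s] summable_hyp_term[of r s] Beta_pos[of r "s - r"]
  by (intro mult_nonneg_nonneg suminf_nonneg) (auto intro: less_imp_le)

lemma beta_integral_eq_kernel_moment:
  assumes "0 < r" "r < s"
  shows "beta_integral (1/2) r s = ennreal (pi * kernel_moment r s)"
  using assms Beta_pos[of r "s - r"]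
  by (simp add: beta_integral_series suminf_hyp_term_ennreal kernel_moment_def mult.assoc flip: ennreal_mult')

lemma beta_integral_transformation:
  "beta_integral r (1/2) s = beta_integral (1 - r) (1/2) (1/2 + s - r)"
  unfolding beta_integral_def
proof (rule nn_integral_cong)
  fix x :: real
  show "ennreal (x powr (1/2 - 1) * (1 - x) powr (s - 1/2 - 1)) * euler_integral r x * indicator {0<..<1} x
    = ennreal (x powr (1/2 - 1) * (1 - x) powr (1/2 + s - r - 1/2 - 1)) * euler_integral (1 - r) x * indicator {0<..<1} x"
  proof (cases "x \<in> {0<..<1}")
    case True
    then have x: "0 < x" "x < 1" by auto
    have "x powr (1/2 - 1) * (1 - x) powr (s - 1/2 - 1) * (1 - x) powr (1/2 - r)
        = x powr (1/2 - 1) * (1 - x) powr (1/2 + s - r - 1/2 - 1)"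
      by (simp add: mult.assoc flip: powr_add)
    then have eq: "ennreal (x powr (1/2 - 1) * (1 - x) powr (s - 1/2 - 1)) * ennreal ((1 - x) powr (1/2 - r))
        = ennreal (x powr (1/2 - 1) * (1 - x) powr (1/2 + s - r - 1/2 - 1))"
      by (metis ennreal_mult'' powr_ge_zero)
    show ?thesis
      unfolding euler_integral_transformation[OF x, of r] eq[symmetric] by (simp only: mult_ac)
  qed simp
qed

lemma hyp_term_commute: "hyp_term a c e n = hyp_term c a e n"
  by (simp add: hyp_term_def mult_ac)

text \<open>
Euler's transformation changes only the exponents of a beta integral with kernel exponent \<open>r\<close> and
beta exponent \<open>1/2\<close>. By the symmetry of the series, that integral is also the moment
\<open>I r s\<close> up to beta values, so \<open>I r s\<close> is related to \<open>I (1 - r) (1/2 + s - r)\<close>.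
\<close>

lemma kernel_moment_transformation:
  assumes r: "0 < r" "r < 1" and s: "r < s" "1/2 < s"
  shows "kernel_moment r s * (Gamma (1 - r) * (Gamma (s - 1/2))\<^sup>2) =
         kernel_moment (1 - r) (1/2 + s - r) * (Gamma r * (Gamma (s - r))\<^sup>2)"
proof -
  let ?S = "\<Sum>n. hyp_term (1/2) r s n" and ?S' = "\<Sum>n. hyp_term (1/2) (1 - r) (1/2 + s - r) n"
  have S: "0 \<le> ?S" "0 \<le> ?S'"
    using assms summable_hyp_term[of r s] summable_hyp_term[of "1 - r" "1/2 + s - r"]
    by (auto intro!: suminf_nonneg intro: less_imp_le[OF hyp_term_pos])
  have B: "0 < Beta (1/2) (s - 1/2)" "0 < Beta (1/2) (s - r)"
    using assms by (auto intro!: Beta_pos)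
  have "ennreal (pi * Beta (1/2) (s - 1/2) * ?S) = beta_integral r (1/2) s"
    using assms B by (simp add: beta_integral_series hyp_term_commute[of r] suminf_hyp_term_ennreal ennreal_mult')
  also have "\<dots> = beta_integral (1 - r) (1/2) (1/2 + s - r)"
    by (rule beta_integral_transformation)
  also have "\<dots> = ennreal (pi * Beta (1/2) (s - r) * ?S')"
    using assms B by (simp add: beta_integral_series hyp_term_commute[of "1 - r"] suminf_hyp_term_ennreal ennreal_mult')
  finally have "Beta (1/2) (s - 1/2) * ?S = Beta (1/2) (s - r) * ?S'"
    using S B by (simp add: ennreal_inj)
  moreover have "Beta (1/2) (s - 1/2) = sqrt pi * (Gamma (s - 1/2) / Gamma s)"
    "Beta (1/2) (s - r) = sqrt pi * (Gamma (s - r) / Gamma (1/2 + s - r))"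
    by (simp_all add: Beta_def Gamma_one_half_real add_diff_eq)
  ultimately have "sqrt pi * (Gamma (s - 1/2) / Gamma s * ?S) =
      sqrt pi * (Gamma (s - r) / Gamma (1/2 + s - r) * ?S')"
    by (simp only: mult.assoc)
  then have eq: "Gamma (s - 1/2) / Gamma s * ?S = Gamma (s - r) / Gamma (1/2 + s - r) * ?S'"
    by (rule mult_left_cancel[THEN iffD1, rotated]) simp
  have "kernel_moment r s * (Gamma (1 - r) * (Gamma (s - 1/2))\<^sup>2) =
     Gamma r * Gamma (s - r) * Gamma (1 - r) * Gamma (s - 1/2) * (Gamma (s - 1/2) / Gamma s * ?S)"
    by (simp add: kernel_moment_def Beta_def power2_eq_square)
  also have "\<dots> = kernel_moment (1 - r) (1/2 + s - r) * (Gamma r * (Gamma (s - r))\<^sup>2)"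
    unfolding eq by (simp add: kernel_moment_def Beta_def power2_eq_square add_diff_eq)
  finally show ?thesis .
qed

text \<open>
The derivative of \<open>4t/(1+t)\<^sup>2\<close> is \<open>4(1-t)/(1+t)\<^sup>3\<close>; the factor \<open>1 + t\<close> of Landen's
transformation lowers the exponent of the denominator to two.
\<close>

lemma nn_integral_landen:
  assumes [measurable]: "f \<in> borel_measurable borel"
  shows "(\<integral>\<^sup>+z\<in>{0<..<1}. f z * euler_integral (1/2) z \<partial>lborel) =
    (\<integral>\<^sup>+t\<in>{0<..<1}. f (4 * t / (1 + t)\<^sup>2) * ennreal (4 * (1 - t) / (1 + t)\<^sup>2) * euler_integral (1/2) (t\<^sup>2) \<partial>lborel)"
proof -
  have "(\<integral>\<^sup>+z\<in>{0<..<1}. f z * euler_integral (1/2) z \<partial>lborel) =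
    (\<integral>\<^sup>+t\<in>{0<..<1}. f (4 * t / (1 + t)\<^sup>2) * euler_integral (1/2) (4 * t / (1 + t)\<^sup>2) *
       ennreal (4 * (1 - t) / (1 + t) ^ 3) \<partial>lborel)"
  proof (rule nn_integral_unit_interval_substitution)
    fix t :: real assume t: "t \<in> {0..1}"
    have "((\<lambda>t. 4 * t) has_real_derivative 4) (at t)"
      by (auto intro!: derivative_eq_intros)
    moreover have "((\<lambda>t. (1 + t)\<^sup>2) has_real_derivative 2 * (1 + t)) (at t)"
      by (auto intro!: derivative_eq_intros)
    ultimately have "((\<lambda>t. 4 * t / (1 + t)\<^sup>2) has_real_derivative
        (4 * (1 + t)\<^sup>2 - 4 * t * (2 * (1 + t))) / ((1 + t)\<^sup>2 * (1 + t)\<^sup>2)) (at t)"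
      using t by (intro DERIV_divide) auto
    moreover have "(4 * p\<^sup>2 - 4 * t * (2 * p)) / (p\<^sup>2 * p\<^sup>2) = 4 * (p - 2 * t) / p ^ 3" if "p > 0" for p
      using that by (simp add: field_simps power2_eq_square power3_eq_cube)
    from this[of "1 + t"] t have "(4 * (1 + t)\<^sup>2 - 4 * t * (2 * (1 + t))) / ((1 + t)\<^sup>2 * (1 + t)\<^sup>2) = 4 * (1 - t) / (1 + t) ^ 3"
      by simp
    ultimately show "((\<lambda>t. 4 * t / (1 + t)\<^sup>2) has_real_derivative 4 * (1 - t) / (1 + t) ^ 3) (at t)"
      by metis
    show "0 \<le> 4 * (1 - t) / (1 + t) ^ 3" using t by simp
  next
    show "continuous_on {0..1} (\<lambda>t::real. 4 * (1 - t) / (1 + t) ^ 3)"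
      by (intro continuous_intros) auto
  qed auto
  also have "\<dots> = (\<integral>\<^sup>+t\<in>{0<..<1}. f (4 * t / (1 + t)\<^sup>2) * ennreal (4 * (1 - t) / (1 + t)\<^sup>2) * euler_integral (1/2) (t\<^sup>2) \<partial>lborel)"
  proof (rule nn_integral_cong)
    fix t :: real
    show "f (4 * t / (1 + t)\<^sup>2) * euler_integral (1/2) (4 * t / (1 + t)\<^sup>2) *
       ennreal (4 * (1 - t) / (1 + t) ^ 3) * indicator {0<..<1} t =
       f (4 * t / (1 + t)\<^sup>2) * ennreal (4 * (1 - t) / (1 + t)\<^sup>2) * euler_integral (1/2) (t\<^sup>2) * indicator {0<..<1} t"
    proof (cases "t \<in> {0<..<1}")
      case True
      then have t: "0 < t" "t < 1" by auto
      have "(1 + t) * (4 * (1 - t) / (1 + t) ^ 3) = 4 * (1 - t) / (1 + t)\<^sup>2"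
        using t by (simp add: power3_eq_cube power2_eq_square)
      then have eq: "ennreal (4 * (1 - t) / (1 + t)\<^sup>2) = ennreal (1 + t) * ennreal (4 * (1 - t) / (1 + t) ^ 3)"
        using t by (metis ennreal_mult' add_nonneg_nonneg less_imp_le zero_le_one)
      show ?thesis unfolding landen_transformation[OF t] eq by (simp only: mult_ac)
    qed simp
  qed
  finally show ?thesis .
qed

lemma nn_integral_square:
  assumes [measurable]: "f \<in> borel_measurable borel"
  shows "(\<integral>\<^sup>+x\<in>{0<..<1}. f x \<partial>lborel) = (\<integral>\<^sup>+t\<in>{0<..<1}. f (t\<^sup>2) * ennreal (2 * t) \<partial>lborel)"
  by (rule nn_integral_unit_interval_substitution) (auto intro!: derivative_eq_intros continuous_intros)

text \<open>
The common form, up to a constant factor, of the four moments related by Landen's transformation;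
each of them has its own polynomial \<open>p\<close>.
\<close>

definition weighted_moment :: "real \<Rightarrow> (real \<Rightarrow> real) \<Rightarrow> ennreal" where
  "weighted_moment r p =
     (\<integral>\<^sup>+t\<in>{0<..<1}. ennreal (t powr (2 * r - 1) * (1 - t\<^sup>2) powr (-2 * r) * p t) *
        euler_integral (1/2) (t\<^sup>2) \<partial>lborel)"

lemma weighted_moment_add:
  assumes [measurable]: "p \<in> borel_measurable borel" "q \<in> borel_measurable borel"
    and "\<And>t. 0 < t \<Longrightarrow> t < 1 \<Longrightarrow> 0 \<le> p t" "\<And>t. 0 < t \<Longrightarrow> t < 1 \<Longrightarrow> 0 \<le> q t"
  shows "weighted_moment r (\<lambda>t. p t + q t) = weighted_moment r p + weighted_moment r q"
  unfolding weighted_moment_def using assms(3,4)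
  by (subst nn_integral_add[symmetric])
     (auto intro!: nn_integral_cong split: split_indicator simp: distrib_left distrib_right)

text \<open>
Here \<open>1 - z = ((1 - t) / (1 + t))\<^sup>2\<close>, which is why the exponent of the second factor is doubled.
\<close>

lemma moment_via_landen:
  assumes w: "\<And>t. 0 < t \<Longrightarrow> t < 1 \<Longrightarrow>
     (4 * t / (1 + t)\<^sup>2) powr (c - 1) * ((1 - t) / (1 + t)) powr (2 * (e - c - 1)) * (4 * (1 - t) / (1 + t)\<^sup>2)
     = K * (t powr (2 * r - 1) * (1 - t\<^sup>2) powr (-2 * r) * p t)" 
    and [measurable]: "p \<in> borel_measurable borel" and K: "0 \<le> K"
  shows "beta_integral (1/2) c e = ennreal K * weighted_moment r p"
proof -
  have "beta_integral (1/2) c e = (\<integral>\<^sup>+t. ennreal K * (ennreal (t powr (2 * r - 1) * (1 - t\<^sup>2) powr (-2 * r) * p t) *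
        euler_integral (1/2) (t\<^sup>2) * indicator {0<..<1} t) \<partial>lborel)"
    unfolding beta_integral_def
  proof (subst nn_integral_landen, goal_cases)
    case 2
    show ?case
    proof (rule nn_integral_cong)
      fix t :: real
      let ?z = "4 * t / (1 + t)\<^sup>2"
      show "ennreal (?z powr (c - 1) * (1 - ?z) powr (e - c - 1)) * ennreal (4 * (1 - t) / (1 + t)\<^sup>2) *
          euler_integral (1/2) (t\<^sup>2) * indicator {0<..<1} t
        = ennreal K * (ennreal (t powr (2 * r - 1) * (1 - t\<^sup>2) powr (-2 * r) * p t) *
        euler_integral (1/2) (t\<^sup>2) * indicator {0<..<1} t)"
      proof (cases "t \<in> {0<..<1}")
        case True
        then have t: "0 < t" "t < 1" by auto
        have "1 - ?z = ((1 - t) / (1 + t))\<^sup>2"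
          using t by (simp add: field_simps) (simp add: power2_eq_square algebra_simps)
        then have "1 - ?z = ((1 - t) / (1 + t)) powr 2" using t by simp
        then have "(1 - ?z) powr (e - c - 1) = ((1 - t) / (1 + t)) powr (2 * (e - c - 1))"
          by (simp add: powr_powr)
        then have "?z powr (c - 1) * (1 - ?z) powr (e - c - 1) * (4 * (1 - t) / (1 + t)\<^sup>2)
          = K * (t powr (2 * r - 1) * (1 - t\<^sup>2) powr (-2 * r) * p t)"
          using w[OF t] by simp
        then have "ennreal (?z powr (c - 1) * (1 - ?z) powr (e - c - 1)) * ennreal (4 * (1 - t) / (1 + t)\<^sup>2)
          = ennreal K * ennreal (t powr (2 * r - 1) * (1 - t\<^sup>2) powr (-2 * r) * p t)"
          using K t by (metis ennreal_mult' mult_nonneg_nonneg powr_ge_zero)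
        then show ?thesis by (simp add: mult_ac)
      qed simp
    qed
  qed measurable
  also have "\<dots> = ennreal K * weighted_moment r p"
    unfolding weighted_moment_def by (rule nn_integral_cmult) measurable
  finally show ?thesis .
qed

lemma moment_via_square:
  assumes w: "\<And>t. 0 < t \<Longrightarrow> t < 1 \<Longrightarrow> t powr (2 * (c - 1)) * (2 * t) = t powr (2 * r - 1) * p t"
    and e: "e - c - 1 = - 2 * r"
  shows "beta_integral (1/2) c e = weighted_moment r p"
  unfolding beta_integral_def weighted_moment_def
proof (subst nn_integral_square, goal_cases)
  case 2
  show ?case
  proof (rule nn_integral_cong)
    fix t :: real
    show "ennreal ((t\<^sup>2) powr (c - 1) * (1 - t\<^sup>2) powr (e - c - 1)) * euler_integral (1/2) (t\<^sup>2) * ennreal (2 * t) * indicator {0<..<1} t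
      = ennreal (t powr (2 * r - 1) * (1 - t\<^sup>2) powr (-2 * r) * p t) * euler_integral (1/2) (t\<^sup>2) * indicator {0<..<1} t"
    proof (cases "t \<in> {0<..<1}")
      case True
      then have t: "0 < t" "t < 1" by auto
      have "t\<^sup>2 = t powr 2" using t by simp
      then have "(t\<^sup>2) powr (c - 1) = t powr (2 * (c - 1))" by (simp only: powr_powr)
      then have "(t\<^sup>2) powr (c - 1) * (1 - t\<^sup>2) powr (e - c - 1) * (2 * t)
         = t powr (2 * r - 1) * (1 - t\<^sup>2) powr (-2 * r) * p t"
        unfolding e using w[OF t] by (simp add: mult_ac)
      then have eq: "ennreal ((t\<^sup>2) powr (c - 1) * (1 - t\<^sup>2) powr (e - c - 1)) * ennreal (2 * t)
         = ennreal (t powr (2 * r - 1) * (1 - t\<^sup>2) powr (-2 * r) * p t)"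
        by (metis ennreal_mult' mult_nonneg_nonneg powr_ge_zero)
      show ?thesis unfolding eq[symmetric] by (simp only: mult_ac)
    qed simp
  qed
qed measurable

text \<open>
With the polynomials \<open>1 + t\<close>, \<open>1 - t\<close>, \<open>2\<close> and \<open>2t\<close> standing for the four moments, the claims are
\<open>(1 + t) + (1 - t) = 2\<close> and \<open>(1 + t) - (1 - t) = 2t\<close>.
\<close>

lemma kernel_moment_landen:
  assumes r: "0 < r" "r < 1/2"
  shows "kernel_moment (2 * r) (r + 1/2) + kernel_moment (2 * r) (r + 1) =
           16 powr r * kernel_moment r (1 - r)" (is ?sum)
    and "kernel_moment (2 * r) (r + 1/2) - kernel_moment (2 * r) (r + 1) =
           16 powr r * kernel_moment (r + 1/2) (3/2 - r)" (is ?diff)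
proof -
  \<comment> \<open>The weight for \<open>e = r + 1/2\<close>; passing to \<open>e = r + 1\<close> multiplies it by
    \<open>(1 - t) / (1 + t)\<close>.\<close>
  have w: "(4 * t / (1 + t)\<^sup>2) powr (2 * r - 1) * ((1 - t) / (1 + t)) powr (-1 - 2 * r) * (4 * (1 - t) / (1 + t)\<^sup>2)
     = 16 powr r * (t powr (2 * r - 1) * (1 - t\<^sup>2) powr (-2 * r) * (1 + t))" if t: "0 < t" "t < 1" for t :: real
  proof -
    have sq: "1 - t\<^sup>2 = (1 - t) * (1 + t)" "(16::real) = 4 powr 2"
      by (simp_all add: power2_eq_square algebra_simps)
    have d: "4 * (1 - t) / (1 + t)\<^sup>2 = exp (ln 4 + ln (1 - t) - 2 * ln (1 + t))"
      using t by (simp add: exp_add exp_diff exp_double)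
    have p: "1 + t = exp (ln (1 + t))" using t by simp
    have "(4 * t / (1 + t)\<^sup>2) powr (2 * r - 1) * ((1 - t) / (1 + t)) powr (-1 - 2 * r) * exp (ln 4 + ln (1 - t) - 2 * ln (1 + t))
     = (4 powr 2) powr r * (t powr (2 * r - 1) * ((1 - t) * (1 + t)) powr (-2 * r) * exp (ln (1 + t)))"
      using t
      by (simp add: powr_powr powr_def ln_mult ln_div ln_realpow del: exp_ln exp_ln_iff flip: exp_add)
         (simp add: field_simps)
    then show ?thesis using t by (simp only: d sq flip: p)
  qed
  have A: "beta_integral (1/2) (2 * r) (r + 1/2) = ennreal (16 powr r) * weighted_moment r (\<lambda>t. 1 + t)"
  proof (rule moment_via_landen)
    have "2 * (r + 1/2 - 2 * r - 1) = -1 - 2 * r" by simp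
    then show "(4 * t / (1 + t)\<^sup>2) powr (2 * r - 1) * ((1 - t) / (1 + t)) powr (2 * (r + 1/2 - 2 * r - 1)) * (4 * (1 - t) / (1 + t)\<^sup>2)
     = 16 powr r * (t powr (2 * r - 1) * (1 - t\<^sup>2) powr (-2 * r) * (1 + t))" if "0 < t" "t < 1" for t :: real
      using w[OF that] by metis
  qed auto
  have B: "beta_integral (1/2) (2 * r) (r + 1) = ennreal (16 powr r) * weighted_moment r (\<lambda>t. 1 - t)"
  proof (rule moment_via_landen)
    fix t :: real assume t: "0 < t" "t < 1"
    have e: "2 * (r + 1 - 2 * r - 1) = (-1 - 2 * r) + 1" by simp
    have extra: "((1 - t) / (1 + t)) powr (2 * (r + 1 - 2 * r - 1)) = ((1 - t) / (1 + t)) powr (-1 - 2 * r) * ((1 - t) / (1 + t))"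
      unfolding e powr_add using t by simp
    have "(4 * t / (1 + t)\<^sup>2) powr (2 * r - 1) * ((1 - t) / (1 + t)) powr (2 * (r + 1 - 2 * r - 1)) * (4 * (1 - t) / (1 + t)\<^sup>2)
      = ((4 * t / (1 + t)\<^sup>2) powr (2 * r - 1) * ((1 - t) / (1 + t)) powr (-1 - 2 * r) * (4 * (1 - t) / (1 + t)\<^sup>2)) * ((1 - t) / (1 + t))"
      unfolding extra by (simp only: mult_ac)
    also have "\<dots> = 16 powr r * (t powr (2 * r - 1) * (1 - t\<^sup>2) powr (-2 * r) * (1 - t))"
      unfolding w[OF t] using t by simp
    finally show "(4 * t / (1 + t)\<^sup>2) powr (2 * r - 1) * ((1 - t) / (1 + t)) powr (2 * (r + 1 - 2 * r - 1)) * (4 * (1 - t) / (1 + t)\<^sup>2)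
     = 16 powr r * (t powr (2 * r - 1) * (1 - t\<^sup>2) powr (-2 * r) * (1 - t))" .
  qed auto
  have E: "beta_integral (1/2) r (1 - r) = weighted_moment r (\<lambda>t. 2)"
  proof (rule moment_via_square)
    fix t :: real assume t: "0 < t" "t < 1"
    have "t powr (2 * (r - 1)) * t powr 1 = t powr (2 * r - 1)" unfolding powr_add[symmetric] by simp
    then show "t powr (2 * (r - 1)) * (2 * t) = t powr (2 * r - 1) * 2" using t by simp
  qed simp
  have M: "beta_integral (1/2) (r + 1/2) (3/2 - r) = weighted_moment r (\<lambda>t. 2 * t)"
  proof (rule moment_via_square)
    fix t :: real assume t: "0 < t" "t < 1"
    have "2 * (r + 1/2 - 1) = 2 * r - 1" by simp
    then show "t powr (2 * (r + 1/2 - 1)) * (2 * t) = t powr (2 * r - 1) * (2 * t)" by metis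
  qed simp
  have nn: "0 \<le> kernel_moment (2 * r) (r + 1/2)" "0 \<le> kernel_moment (2 * r) (r + 1)"
     "0 \<le> kernel_moment r (1 - r)" "0 \<le> kernel_moment (r + 1/2) (3/2 - r)"
    using r by (auto intro!: kernel_moment_nonneg)
  have "weighted_moment r (\<lambda>t. 1 + t) + weighted_moment r (\<lambda>t. 1 - t) = weighted_moment r (\<lambda>t. 2)"
    by (subst weighted_moment_add[symmetric]) auto
  then have "beta_integral (1/2) (2 * r) (r + 1/2) + beta_integral (1/2) (2 * r) (r + 1) =
      ennreal (16 powr r) * beta_integral (1/2) r (1 - r)"
    unfolding A B E by (simp flip: distrib_left)
  then have "ennreal (pi * kernel_moment (2 * r) (r + 1/2) + pi * kernel_moment (2 * r) (r + 1)) =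
      ennreal (16 powr r * (pi * kernel_moment r (1 - r)))"
    using r nn by (simp add: beta_integral_eq_kernel_moment ennreal_mult' ennreal_plus)
  then have "pi * (kernel_moment (2 * r) (r + 1/2) + kernel_moment (2 * r) (r + 1)) = pi * (16 powr r * kernel_moment r (1 - r))"
    using nn by (subst (asm) ennreal_inj) (auto simp: algebra_simps)
  then show ?sum by simp
  have "weighted_moment r (\<lambda>t. 1 - t) + weighted_moment r (\<lambda>t. 2 * t) = weighted_moment r (\<lambda>t. (1 - t) + 2 * t)"
    by (subst weighted_moment_add) auto
  also have "(\<lambda>t::real. (1 - t) + 2 * t) = (\<lambda>t. 1 + t)" by auto
  finally have "beta_integral (1/2) (2 * r) (r + 1) + ennreal (16 powr r) * beta_integral (1/2) (r + 1/2) (3/2 - r) =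
      beta_integral (1/2) (2 * r) (r + 1/2)"
    unfolding A B M by (simp flip: distrib_left)
  then have "ennreal (pi * kernel_moment (2 * r) (r + 1) + 16 powr r * (pi * kernel_moment (r + 1/2) (3/2 - r))) =
      ennreal (pi * kernel_moment (2 * r) (r + 1/2))"
    using r nn by (simp add: beta_integral_eq_kernel_moment ennreal_mult' ennreal_plus)
  then have "pi * (kernel_moment (2 * r) (r + 1) + 16 powr r * kernel_moment (r + 1/2) (3/2 - r)) = pi * kernel_moment (2 * r) (r + 1/2)"
    using nn by (subst (asm) ennreal_inj) (auto simp: algebra_simps)
  then show ?diff by simp
qed

section \<open>The three-term relation\<close>

lemma Gamma_reflection_real: "Gamma z * Gamma (1 - z) = pi / sin (pi * z)" for z :: real
proof -
  have "complex_of_real (Gamma z * Gamma (1 - z)) = complex_of_real (pi / sin (pi * z))"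
    unfolding of_real_mult of_real_divide Gamma_complex_of_real[symmetric] sin_of_real[symmetric] of_real_diff of_real_1
    by (rule Gamma_reflection_complex)
  then show ?thesis by (simp only: of_real_eq_iff)
qed

lemma Gamma_duplication_real:
  fixes z :: real
  assumes "0 < z"
  shows "Gamma z * Gamma (z + 1/2) = 2 powr (1 - 2 * z) * sqrt pi * Gamma (2 * z)"
proof -
  have n: "complex_of_real x \<notin> \<int>\<^sub>\<le>\<^sub>0" if "0 < x" for x
    using that by (auto elim!: nonpos_Ints_cases simp: complex_eq_iff)
  have "Gamma (complex_of_real z) * Gamma (complex_of_real (z + 1/2)) =
      exp (complex_of_real ((1 - 2 * z) * ln 2)) * complex_of_real (sqrt pi) * Gamma (complex_of_real (2 * z))"
    using Gamma_legendre_duplication[of "of_real z"] n[of z] n[of "z + 1/2"] assms by simp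
  then have "complex_of_real (Gamma z * Gamma (z + 1/2)) =
      complex_of_real (exp ((1 - 2 * z) * ln 2) * sqrt pi * Gamma (2 * z))"
    unfolding Gamma_complex_of_real exp_of_real of_real_mult[symmetric] .
  then show ?thesis by (simp only: of_real_eq_iff powr_def) simp
qed

text \<open>
The four auxiliary moments \<open>a, b, a', b'\<close> are eliminated between the two relations. The Thomae
quotients contain \<open>\<Gamma> (2r)\<close> and \<open>\<Gamma> (1 - 2r)\<close>; duplication turns them into products that reflection
evaluates, so that only sine and cosine of \<open>\<pi> r\<close> survive.
\<close>

theorem kernel_moment_three_term:
  assumes r: "0 < r" "r < 1/2"
  shows "kernel_moment r (1 - r) =
     2 * 16 powr (-r) * sin (2 * pi * r) * kernel_moment (1/2 - r) (1/2 + r)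
     - cos (2 * pi * r) * kernel_moment (1/2 + r) (3/2 - r)"
proof -
  define a b where "a = kernel_moment (2 * r) (r + 1/2)" and "b = kernel_moment (2 * r) (r + 1)"
  define a' b' where "a' = kernel_moment (1 - 2 * r) (1 - r)" and "b' = kernel_moment (1 - 2 * r) (3/2 - r)"
  define e n m where "e = kernel_moment r (1 - r)" and "n = kernel_moment (1/2 - r) (1/2 + r)"
    and "m = kernel_moment (1/2 + r) (3/2 - r)"
  define q where "q = 16 powr r"
  define S C where "S = sin (pi * r)" and "C = cos (pi * r)"
  have q: "0 < q" by (simp add: q_def)
  have pr: "0 < pi * r" "pi * r < pi / 2" using r by (auto simp: field_simps)
  have SC: "0 < S" "0 < C" "S\<^sup>2 + C\<^sup>2 = 1"
    using pr unfolding S_def C_def by (auto intro!: sin_gt_zero cos_gt_zero)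
  have G: "0 < Gamma r" "0 < Gamma (r + 1/2)" "0 < Gamma (1/2 - r)" "0 < Gamma (1 - r)" "0 < Gamma (2 * r)" "0 < Gamma (1 - 2 * r)"
    using r by (auto intro!: Gamma_real_pos)
  have l: "a + b = q * e" "a - b = q * m"
    using kernel_moment_landen[OF r] unfolding a_def b_def e_def m_def q_def by (simp_all add: add.commute)
  have "a' + b' = 16 powr (1/2 - r) * n"
    using kernel_moment_landen(1)[of "1/2 - r"] r unfolding a'_def b'_def n_def by (simp add: algebra_simps)
  moreover have "16 powr (1/2 - r) = 4 / q"
    by (simp add: q_def powr_diff powr_half_sqrt)
  ultimately have l': "a' + b' = 4 / q * n" by simp
  have dup: "Gamma r * Gamma (r + 1/2) = 2 powr (1 - 2 * r) * sqrt pi * Gamma (2 * r)"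
      "Gamma (1/2 - r) * Gamma (1 - r) = 2 powr (2 * r) * sqrt pi * Gamma (1 - 2 * r)"
    using Gamma_duplication_real[of r] Gamma_duplication_real[of "1/2 - r"] r by (simp_all add: algebra_simps)
  have reflection: "Gamma r * Gamma (1 - r) = pi / S" "Gamma (r + 1/2) * Gamma (1/2 - r) = pi / C"
  proof -
    show "Gamma r * Gamma (1 - r) = pi / S" by (simp add: Gamma_reflection_real S_def)
    have "sin (pi * (r + 1/2)) = C" unfolding C_def by (simp add: distrib_left sin_add)
    then show "Gamma (r + 1/2) * Gamma (1/2 - r) = pi / C"
      using Gamma_reflection_real[of "r + 1/2"] by (simp add: algebra_simps)
  qed
  \<comment> \<open>In this normalisation duplication applies to \<open>\<Gamma> (2r)\<close> and \<open>\<Gamma> (1 - 2r)\<close> at once in the two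
    Thomae relations, and the powers of two add up to \<open>q\<close>.\<close>
  have pw: "2 powr (2 * r) * 2 * Gamma (2 * r) * sqrt pi = q * (Gamma r * Gamma (r + 1/2))"
  proof -
    have "q = 2 powr (4 * r)" using powr_powr[of 2 4 r] by (simp add: q_def)
    then have "q * 2 powr (1 - 2 * r) = 2 powr (2 * r) * 2"
      by (simp add: powr_add[symmetric]) (simp add: powr_add)
    then show ?thesis unfolding dup(1) by (simp add: mult_ac)
  qed
  have "a * (Gamma (1 - 2 * r) * (Gamma r)\<^sup>2) = a' * (Gamma (2 * r) * (Gamma (1/2 - r))\<^sup>2)"
    using kernel_moment_transformation[of "2 * r" "r + 1/2"] r unfolding a_def a'_def by (simp add: algebra_simps)
  then have "a * (2 powr (2 * r) * sqrt pi * Gamma (1 - 2 * r)) * 2 * (Gamma r)\<^sup>2 =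
      a' * (2 powr (2 * r) * 2 * Gamma (2 * r) * sqrt pi) * (Gamma (1/2 - r))\<^sup>2"
    by simp
  then have "a * 2 * (Gamma r * Gamma (1 - r)) = a' * q * (Gamma (r + 1/2) * Gamma (1/2 - r))"
    unfolding pw dup(2)[symmetric] using G by (simp add: power2_eq_square) (simp only: mult_ac)
  then have ta: "a * C = a' * (q / 2) * S"
    unfolding reflection using SC by (simp add: field_simps)
  have "b * (Gamma (1 - 2 * r) * (Gamma (r + 1/2))\<^sup>2) = b' * (Gamma (2 * r) * (Gamma (1 - r))\<^sup>2)"
    using kernel_moment_transformation[of "2 * r" "r + 1"] r unfolding b_def b'_def by (simp add: algebra_simps)
  then have "b * (2 powr (2 * r) * sqrt pi * Gamma (1 - 2 * r)) * 2 * (Gamma (r + 1/2))\<^sup>2 =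
      b' * (2 powr (2 * r) * 2 * Gamma (2 * r) * sqrt pi) * (Gamma (1 - r))\<^sup>2"
    by simp
  then have "b * 2 * (Gamma (r + 1/2) * Gamma (1/2 - r)) = b' * q * (Gamma r * Gamma (1 - r))"
    unfolding pw dup(2)[symmetric] using G by (simp add: power2_eq_square) (simp add: mult_ac)?
  then have tb: "b * S = b' * (q / 2) * C"
    unfolding reflection using SC by (simp add: field_simps)
  have "4 * (S * C) * n = S * C * q * (a' + b')" using l' q by simp
  also have "\<dots> = 2 * (a * C) * C + 2 * (b * S) * S" unfolding ta tb by (simp add: algebra_simps)
  also have "\<dots> = q * (e * (S\<^sup>2 + C\<^sup>2) + m * (C\<^sup>2 - S\<^sup>2))"
  proof -
    have ab: "a = q * (e + m) / 2" "b = q * (e - m) / 2" using l by (simp_all add: algebra_simps)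
    show ?thesis unfolding ab by (simp add: field_simps power2_eq_square)
  qed
  finally have "q * e = 2 * (2 * S * C) * n - q * ((C\<^sup>2 - S\<^sup>2) * m)"
    unfolding SC(3) by (simp add: algebra_simps)
  then have "e = 2 / q * (2 * S * C) * n - (C\<^sup>2 - S\<^sup>2) * m"
    using q by (simp add: field_simps)
  moreover have "2 * S * C = sin (2 * pi * r)" "C\<^sup>2 - S\<^sup>2 = cos (2 * pi * r)"
    using sin_double[of "pi * r"] cos_double[of "pi * r"] by (simp_all add: S_def C_def mult.assoc)
  moreover have "2 / q = 2 * 16 powr (-r)" by (simp add: q_def powr_minus divide_inverse)
  ultimately show ?thesis unfolding e_def n_def m_def by simp
qed

lemma hypergeo_pFq_eq_suminf: "hypergeo_pFq [1/2, 1/2, r] [1, s] 1 = (\<Sum>n. hyp_term (1/2) r s n)"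
  unfolding hypergeo_pFq_def eval_fps_def hyp_term_def
  by (rule suminf_cong) (simp add: pochhammer_fact[symmetric] mult_ac)

lemma F_hyp_eq_kernel_moment:
  "F_hyp (r, s) = 2 powr (1 - 4 * of_rat r) / N_level r * kernel_moment (of_rat r) (of_rat s)"
  unfolding F_hyp_def kernel_moment_def by (simp add: hypergeo_pFq_eq_suminf of_rat_diff)

lemma N_level_neq_0: "N_level r \<noteq> 0"
  by (simp add: N_level_def)

text \<open>
The factors \<open>2 powr (1 - 4r)\<close> of the three terms combine with \<open>16 powr (-r)\<close>; for rational \<open>r\<close> all
coefficients below are algebraic.
\<close>

theorem F_hyp_three_term:
  fixes r :: rat
  assumes r: "0 < r" "r < 1/2"
  shows "F_hyp (r, 1 - r) =
     2 powr (3 - 12 * of_rat r) * sin (2 * pi * of_rat r) * (N_level (1/2 - r) / N_level r)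
       * F_hyp (1/2 - r, 1/2 + r)
     - 4 * cos (2 * pi * of_rat r) * (N_level (1/2 + r) / N_level r) * F_hyp (1/2 + r, 3/2 - r)"
proof -
  define x :: real where "x = of_rat r"
  have "x < of_rat (1/2)" unfolding x_def of_rat_less by (rule r)
  then have x: "0 < x" "x < 1/2" using r by (simp_all add: x_def of_rat_divide)
  have c: "of_rat (1 - r) = 1 - x" "of_rat (1/2 - r) = 1/2 - x" "of_rat (1/2 + r) = 1/2 + x"
      "of_rat (3/2 - r) = 3/2 - x"
    by (simp_all add: x_def of_rat_diff of_rat_add of_rat_divide)
  have "(16::real) powr (-x) = 2 powr (- 4 * x)" using powr_powr[of 2 4 "-x"] by simp
  then have p1: "2 powr (1 - 4 * x) * (2 * 16 powr (-x)) = 2 powr (3 - 12 * x) * 2 powr (1 - 4 * (1/2 - x))"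
    using powr_add[of 2 1 "- 4 * x"] powr_add[of 2 2 "- 8 * x"]
    by (simp flip: powr_add)
  have p2: "2 powr (1 - 4 * x) = 4 * 2 powr (1 - 4 * (1/2 + x))"
    using powr_add[of 2 2 "1 - 4 * (1/2 + x)"] by simp
  let ?n = "kernel_moment (1/2 - x) (1/2 + x)" and ?m = "kernel_moment (1/2 + x) (3/2 - x)"
  have "N_level r * F_hyp (r, 1 - r) = 2 powr (1 - 4 * x) * kernel_moment x (1 - x)"
    by (simp add: F_hyp_eq_kernel_moment c N_level_neq_0 flip: x_def)
  also have "\<dots> = (2 powr (1 - 4 * x) * (2 * 16 powr (-x))) * sin (2 * pi * x) * ?n
      - 2 powr (1 - 4 * x) * cos (2 * pi * x) * ?m"
    unfolding kernel_moment_three_term[OF x] by (simp add: algebra_simps)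
  also have "\<dots> = 2 powr (3 - 12 * x) * sin (2 * pi * x) * (2 powr (1 - 4 * (1/2 - x)) * ?n)
      - 4 * cos (2 * pi * x) * (2 powr (1 - 4 * (1/2 + x)) * ?m)"
    unfolding p1 unfolding p2 by (simp only: mult_ac)
  also have "2 powr (1 - 4 * (1/2 - x)) * ?n = N_level (1/2 - r) * F_hyp (1/2 - r, 1/2 + r)"
    by (simp add: F_hyp_eq_kernel_moment c N_level_neq_0)
  also have "2 powr (1 - 4 * (1/2 + x)) * ?m = N_level (1/2 + r) * F_hyp (1/2 + r, 3/2 - r)"
    by (simp add: F_hyp_eq_kernel_moment c N_level_neq_0)
  finally show ?thesis
    unfolding x_def[symmetric] using N_level_neq_0[of r] by (simp add: field_simps)
qed

lemma F_hyp_relation_1_8: "F_hyp (1/8, 7/8) = 2 * F_hyp (3/8, 5/8) - sqrt 8 * F_hyp (5/8, 11/8)"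
proof -
  have N: "N_level (1/8) = 16" "N_level (3/8) = 16" "N_level (5/8) = 16"
    by (simp_all add: N_level_def gcd_non_0_int)
  have "2 powr (3/2) * sqrt 2 / 2 = (2::real) powr (3/2) * 2 powr (1/2) / 2"
    by (simp add: powr_half_sqrt)
  also have "\<dots> = 2" by (simp flip: powr_add)
  finally have p: "2 powr (3/2) * sqrt 2 = (4::real)" by simp
  have "sqrt 8 = sqrt (4 * 2)" by simp
  then have "sqrt 8 = 2 * sqrt 2" unfolding real_sqrt_mult by simp
  with F_hyp_three_term[of "1/8"] p show ?thesis
    by (simp add: N of_rat_divide sin_45 cos_45)
qed

lemma F_hyp_relation_1_12: "F_hyp (1/12, 11/12) = 2 * F_hyp (5/12, 7/12) - sqrt 12 * F_hyp (7/12, 17/12)"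
proof -
  have N: "N_level (1/12) = 24" "N_level (5/12) = 24" "N_level (7/12) = 24"
    by (simp_all add: N_level_def gcd_non_0_int)
  have "sqrt 12 = sqrt (4 * 3)" by simp
  then have "sqrt 12 = 2 * sqrt 3" unfolding real_sqrt_mult by simp
  with F_hyp_three_term[of "1/12"] show ?thesis
    by (simp add: N of_rat_divide sin_30 cos_30)
qed

lemma algebraic_sqrt: "algebraic (complex_of_real (sqrt (real k)))"
proof (rule algebraicI)
  show "coeff [:- of_nat k, 0, 1::complex:] i \<in> \<int>" for i
    by (auto simp: coeff_pCons split: nat.splits)
  show "poly [:- of_nat k, 0, 1:] (complex_of_real (sqrt (real k))) = 0"
    by (simp flip: of_real_mult)
qed simp

theorem theorem1p3:
  fixes r s :: rat
  assumes "(r, s) \<in> {(1/8, 5/8), (1/8, 7/8), (1/12, 11/12)}"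
  shows "\<exists>\<alpha>1 \<alpha>2 :: complex. algebraic \<alpha>1 \<and> algebraic \<alpha>2 \<and>
           complex_of_real (F_hyp (r, s)) =
             \<alpha>1 * complex_of_real (F_hyp (M1_map (r, s))) +
             \<alpha>2 * complex_of_real (F_hyp (M2_map (r, s)))"
proof -
  consider "r = 1/8" "s = 5/8" | "r = 1/8" "s = 7/8" | "r = 1/12" "s = 11/12"
    using assms by auto
  then show ?thesis
  proof cases
    case 1
    then have "M1_map (r, s) = (r, s)" by (simp add: M1_map_apply)
    then show ?thesis by (intro exI[of _ 1] exI[of _ 0]) simp
  next
    case 2
    then have "M1_map (r, s) = (3/8, 5/8)" "M2_map (r, s) = (5/8, 11/8)"
      by (simp_all add: M1_map_apply M2_map_apply)
    moreover have "algebraic (- complex_of_real (sqrt 8))" using algebraic_sqrt[of 8] by (intro algebraic_minus) simp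
    ultimately have "algebraic (2 :: complex) \<and> algebraic (- complex_of_real (sqrt 8)) \<and>
        complex_of_real (F_hyp (r, s)) = 2 * complex_of_real (F_hyp (M1_map (r, s))) +
          (- complex_of_real (sqrt 8)) * complex_of_real (F_hyp (M2_map (r, s)))"
      unfolding 2 F_hyp_relation_1_8 by simp
    then show ?thesis by blast
  next
    case 3
    then have "M1_map (r, s) = (5/12, 7/12)" "M2_map (r, s) = (7/12, 17/12)"
      by (simp_all add: M1_map_apply M2_map_apply)
    moreover have "algebraic (- complex_of_real (sqrt 12))" using algebraic_sqrt[of 12] by (intro algebraic_minus) simp
    ultimately have "algebraic (2 :: complex) \<and> algebraic (- complex_of_real (sqrt 12)) \<and>
        complex_of_real (F_hyp (r, s)) = 2 * complex_of_real (F_hyp (M1_map (r, s))) +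
          (- complex_of_real (sqrt 12)) * complex_of_real (F_hyp (M2_map (r, s)))"
      unfolding 3 F_hyp_relation_1_12 by simp
    then show ?thesis by blast
  qed
qed

end
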